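(* Let $k$ be an $F$-finite field of characteristic $p>0$, $n\ge2$, $d>2$, and let $B\subseteq\mathbb{N}^n$ be the semigroup generated by a set $U$ with $\{\mathbf{m}\in T_{n,d}:\max(\mathbf{m})\ge d-1\}\subseteq U\subseteq T_{n,d}$. Then the affine semigroup ring $k[B]$ is $F$-nilpotent.
   Context: $T_{n,d}=\{\mathbf{a}\in\mathbb{N}^n:\sum a_i=d\}$, $\max(\mathbf{a})=\max_i a_i$. $k[B]\subseteq k[x_1,\dots,x_n]$ is the $k$-subalgebra generated by monomials with exponent vectors in $U$; it is a graded domain of dimension $n$ with homogeneous maximal ideal $\mathfrak{m}$. Frobenius induces $F$ on $H^j_{\mathfrak{m}}(k[B])$. With $0^*_{H^n_{\mathfrak{m}}(R)}=\{\xi:\exists\,0\ne c\in R,\ cF^e(\xi)=0\ \forall e\gg0\}$, a ring $R$ of dimension $n$ is $F$-nilpotent if for each $j<n$ some $F^e$ vanishes on $H^j_{\mathfrak{m}}(R)$ and some $F^e$ vanishes on $0^*_{H^n_{\mathfrak{m}}(R)}$. *)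

theory Defs
  imports Main "HOL-Computational_Algebra.Primes"
begin

text \<open>Exponent vectors are functions nat => int; vectors of Z^n vanish outside {..<n}.
Elements of the Laurent ring k[Z^n] are finitely supported functions (nat => int) => k.
The semigroup ring k[B] and its monomial localisations are the subsets of those
functions with support in B, resp. in B - N*v.\<close>

definition Tnd :: "nat \<Rightarrow> nat \<Rightarrow> (nat \<Rightarrow> int) set" where
  "Tnd n d = {a. (\<forall>i. 0 \<le> a i) \<and> (\<forall>i\<ge>n. a i = 0) \<and> (\<Sum>i<n. a i) = int d}"

definition maxv :: "nat \<Rightarrow> (nat \<Rightarrow> int) \<Rightarrow> int" where
  "maxv n a = Max (a ` {..<n})"

inductive_set semigrp :: "(nat \<Rightarrow> int) set \<Rightarrow> (nat \<Rightarrow> int) set" for U where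
  zero: "(\<lambda>_. 0) \<in> semigrp U"
| step: "b \<in> semigrp U \<Longrightarrow> u \<in> U \<Longrightarrow> (\<lambda>i. b i + u i) \<in> semigrp U"

definition fsupp :: "((nat \<Rightarrow> int) \<Rightarrow> 'k::field) \<Rightarrow> (nat \<Rightarrow> int) set" where
  "fsupp f = {a. f a \<noteq> 0}"

definition lau_elems :: "(nat \<Rightarrow> int) set \<Rightarrow> ((nat \<Rightarrow> int) \<Rightarrow> 'k::field) set" where
  "lau_elems S = {f. finite (fsupp f) \<and> fsupp f \<subseteq> S}"

abbreviation semigroup_ring :: "(nat \<Rightarrow> int) set \<Rightarrow> ((nat \<Rightarrow> int) \<Rightarrow> 'k::field) set" where
  "semigroup_ring B \<equiv> lau_elems B"

text \<open>A fixed enumeration of the monomial generators x^u, u in U, of the homogeneous maximal ideal.\<close>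
definition gens :: "(nat \<Rightarrow> int) set \<Rightarrow> (nat \<Rightarrow> int) list" where
  "gens U = (SOME us. set us = U \<and> distinct us)"

definition vI :: "(nat \<Rightarrow> int) set \<Rightarrow> nat set \<Rightarrow> (nat \<Rightarrow> int)" where
  "vI U I = (\<lambda>i. \<Sum>l\<in>I. (gens U ! l) i)"

text \<open>Exponent support of the localisation k[B]_{x^v} inside k[Z^n].\<close>
definition locsupp :: "(nat \<Rightarrow> int) set \<Rightarrow> (nat \<Rightarrow> int) \<Rightarrow> (nat \<Rightarrow> int) set" where
  "locsupp B v = {a. \<exists>b\<in>B. \<exists>t::nat. a = (\<lambda>i. b i - int t * v i)}"

text \<open>Cech complex of k[B] with respect to the generators x^u (u in U) of the maximal ideal:
a j-cochain assigns to each j-subset I of the index set an element of k[B]_{x^{u_I}}.\<close>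
definition cech_C :: "(nat \<Rightarrow> int) set \<Rightarrow> (nat \<Rightarrow> int) set \<Rightarrow> nat
    \<Rightarrow> (nat set \<Rightarrow> (nat \<Rightarrow> int) \<Rightarrow> 'k::field) set" where
  "cech_C B U j = {c. \<forall>I. if I \<subseteq> {..<length (gens U)} \<and> card I = j
       then c I \<in> lau_elems (locsupp B (vI U I)) else c I = (\<lambda>_. 0)}"

definition cech_d :: "(nat \<Rightarrow> int) set \<Rightarrow> (nat set \<Rightarrow> (nat \<Rightarrow> int) \<Rightarrow> 'k::field)
    \<Rightarrow> (nat set \<Rightarrow> (nat \<Rightarrow> int) \<Rightarrow> 'k)" where
  "cech_d U c = (\<lambda>I a. if I \<subseteq> {..<length (gens U)}
       then (\<Sum>i\<in>I. (-1) ^ card {l\<in>I. l < i} * c (I - {i}) a) else 0)"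

definition cocycles :: "(nat \<Rightarrow> int) set \<Rightarrow> (nat \<Rightarrow> int) set \<Rightarrow> nat
    \<Rightarrow> (nat set \<Rightarrow> (nat \<Rightarrow> int) \<Rightarrow> 'k::field) set" where
  "cocycles B U j = {c \<in> cech_C B U j. cech_d U c = (\<lambda>I a. 0)}"

definition coboundaries :: "(nat \<Rightarrow> int) set \<Rightarrow> (nat \<Rightarrow> int) set \<Rightarrow> nat
    \<Rightarrow> (nat set \<Rightarrow> (nat \<Rightarrow> int) \<Rightarrow> 'k::field) set" where
  "coboundaries B U j = insert (\<lambda>I a. 0)
      {x. \<exists>y. 0 < j \<and> y \<in> cech_C B U (j - 1) \<and> x = cech_d U y}"

text \<open>Frobenius on k[Z^n]: sum c_a x^a |-> sum c_a^p x^(p a); extended componentwise to cochains.\<close>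
definition frob :: "nat \<Rightarrow> ((nat \<Rightarrow> int) \<Rightarrow> 'k::field) \<Rightarrow> ((nat \<Rightarrow> int) \<Rightarrow> 'k)" where
  "frob p f = (\<lambda>a. if \<forall>i. int p dvd a i then (f (\<lambda>i. a i div int p)) ^ p else 0)"

definition frobC :: "nat \<Rightarrow> (nat set \<Rightarrow> (nat \<Rightarrow> int) \<Rightarrow> 'k::field)
    \<Rightarrow> (nat set \<Rightarrow> (nat \<Rightarrow> int) \<Rightarrow> 'k)" where
  "frobC p c = (\<lambda>I. frob p (c I))"

definition lmult :: "((nat \<Rightarrow> int) \<Rightarrow> 'k::field) \<Rightarrow> ((nat \<Rightarrow> int) \<Rightarrow> 'k) \<Rightarrow> ((nat \<Rightarrow> int) \<Rightarrow> 'k)" where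
  "lmult c f = (\<lambda>a. \<Sum>b\<in>fsupp c. c b * f (\<lambda>i. a i - b i))"

definition multC :: "((nat \<Rightarrow> int) \<Rightarrow> 'k::field) \<Rightarrow> (nat set \<Rightarrow> (nat \<Rightarrow> int) \<Rightarrow> 'k)
    \<Rightarrow> (nat set \<Rightarrow> (nat \<Rightarrow> int) \<Rightarrow> 'k)" where
  "multC c x = (\<lambda>I. lmult c (x I))"

definition F_finite_field :: "'k::field itself \<Rightarrow> bool" where
  "F_finite_field _ \<longleftrightarrow> (\<exists>S::'k set. finite S \<and>
      (\<forall>x::'k. \<exists>a. x = (\<Sum>s\<in>S. a s ^ CHAR('k) * s)))"

text \<open>F-nilpotence of k[B] (of dimension n), with H^j_m computed as Cech cohomology
with respect to the monomial generators of m; H^j = cocycles / coboundaries.\<close>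
definition F_nilpotent_sg :: "'k::field itself \<Rightarrow> nat \<Rightarrow> (nat \<Rightarrow> int) set \<Rightarrow> (nat \<Rightarrow> int) set \<Rightarrow> bool" where
  "F_nilpotent_sg _ n B U \<longleftrightarrow>
    (\<forall>j<n. \<exists>e. \<forall>\<xi>\<in>(cocycles B U j :: (nat set \<Rightarrow> (nat \<Rightarrow> int) \<Rightarrow> 'k) set).
        (frobC CHAR('k) ^^ e) \<xi> \<in> coboundaries B U j) \<and>
    (\<exists>e. \<forall>\<xi>\<in>(cocycles B U n :: (nat set \<Rightarrow> (nat \<Rightarrow> int) \<Rightarrow> 'k) set).
        (\<exists>c\<in>(semigroup_ring B :: ((nat \<Rightarrow> int) \<Rightarrow> 'k) set). c \<noteq> (\<lambda>_. 0) \<and>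
           (\<exists>e0. \<forall>e'\<ge>e0. multC c ((frobC CHAR('k) ^^ e') \<xi>) \<in> coboundaries B U n))
        \<longrightarrow> (frobC CHAR('k) ^^ e) \<xi> \<in> coboundaries B U n)"

end

theory Submission
  imports Defs
begin

text \<open>
  Everything is graded by \<open>\<int>\<^sup>n\<close>. Let \<open>S\<close> be the full Veronese semigroup. After inverting any
  generator, \<open>k[B]\<close> and \<open>k[S]\<close> agree, because \<open>S - B\<close> is finite; so the Cech complexes differ
  only in the term indexed by the empty set. In degree \<open>a\<close> the complex consists of the simplices
  \<open>I\<close> of generators whose joint support contains \<open>{l. a l < 0}\<close>. If some \<open>a k \<ge> 0\<close>, coning with
  the generator \<open>d e\<^sub>k\<close> contracts it, except that for \<open>a \<in> S - B\<close> there is a class in \<open>H\<^sup>1\<close>; Frobenius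
  moves such a degree into \<open>B\<close>. If all \<open>a k < 0\<close>, cohomology vanishes below degree \<open>n\<close>, and a
  top cocycle bounds iff its value on the simplex of the vertices \<open>d e\<^sub>1, \<dots>, d e\<^sub>n\<close> is zero.
  That value commutes with Frobenius and with monomial multiplication as long as the degree stays
  negative, and this makes the tight closure of zero in \<open>H\<^sup>n\<close> vanish.
\<close>

section \<open>Simplicial cochains supported on covering faces\<close>

text \<open>The count never involves \<open>i\<close>, so the sign is the same whether
  \<open>i\<close> is to be removed from \<open>I\<close> or adjoined to it; cones need
  both.\<close>

definition face_sign :: "nat set \<Rightarrow> nat \<Rightarrow> 'k::comm_ring_1" where
  "face_sign I i = (-1) ^ card {l\<in>I. l < i}"

definition simplicial_d :: "(nat set \<Rightarrow> 'k::comm_ring_1) \<Rightarrow> nat set \<Rightarrow> 'k" where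
  "simplicial_d c I = (\<Sum>i\<in>I. face_sign I i * c (I - {i}))"

lemma face_sign_square [simp]: "face_sign I i * face_sign I i = 1"
  by (simp add: face_sign_def flip: power_add)

lemma face_sign_insert_self [simp]: "face_sign (insert i I) i = face_sign I i"
  unfolding face_sign_def by (rule arg_cong[where f="\<lambda>A. (-1) ^ card A"]) auto

lemma face_sign_remove_self [simp]: "face_sign (I - {i}) i = face_sign I i"
  unfolding face_sign_def by (rule arg_cong[where f="\<lambda>A. (-1) ^ card A"]) auto

lemma face_sign_remove_greater: "\<not> i < j \<Longrightarrow> face_sign (I - {i}) j = face_sign I j"
  unfolding face_sign_def by (rule arg_cong[where f="\<lambda>A. (-1) ^ card A"]) auto

lemma face_sign_remove_less:
  assumes "finite I" "i \<in> I" "i < j"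
  shows "face_sign (I - {i}) j = - face_sign I j"
proof -
  have *: "{l\<in>I. l < j} = insert i {l\<in>I - {i}. l < j}" using assms by auto
  have "card {l\<in>I. l < j} = Suc (card {l\<in>I - {i}. l < j})"
    unfolding * using assms(1) by (subst card_insert_disjoint) auto
  then show ?thesis unfolding face_sign_def by simp
qed

text \<open>Removing the smaller vertex shifts the position of the larger by one, removing the
  larger leaves the smaller in place: exactly one sign flips.\<close>

lemma face_sign_swap:
  assumes "finite I" "i \<in> I" "j \<in> I" "i \<noteq> j"
  shows "face_sign I i * face_sign (I - {i}) j = - (face_sign I j * face_sign (I - {j}) i)"
  by (cases "i < j")
    (use assms in \<open>simp_all add: face_sign_remove_less face_sign_remove_greater\<close>)

text \<open>The two orders of removing a pair of vertices give opposite terms. Splitting the sum by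
  order makes them cancel in pairs, which also works in characteristic two.\<close>

lemma simplicial_d_simplicial_d:
  assumes "finite I"
  shows "simplicial_d (simplicial_d c) I = (0 :: 'k::comm_ring_1)"
proof -
  define g where "g i j = face_sign I i * face_sign (I - {i}) j * c (I - {i} - {j})" for i j
  have anti: "g j i = - g i j" if "i \<in> I" "j \<in> I" "i \<noteq> j" for i j
  proof -
    have "I - {j} - {i} = I - {i} - {j}" by auto
    then show ?thesis
      unfolding g_def face_sign_swap[OF assms that] by simp
  qed
  have "simplicial_d (simplicial_d c) I = (\<Sum>i\<in>I. \<Sum>j\<in>I - {i}. g i j)"
    unfolding simplicial_d_def g_def by (simp add: sum_distrib_left mult.assoc)
  also have "\<dots> = (\<Sum>i\<in>I. (\<Sum>j\<in>{j\<in>I. j < i}. g i j) + (\<Sum>j\<in>{j\<in>I. i < j}. g i j))"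
  proof (rule sum.cong[OF refl])
    fix i assume "i \<in> I"
    have *: "I - {i} = {j\<in>I. j < i} \<union> {j\<in>I. i < j}" by auto
    show "(\<Sum>j\<in>I - {i}. g i j) = (\<Sum>j\<in>{j\<in>I. j < i}. g i j) + (\<Sum>j\<in>{j\<in>I. i < j}. g i j)"
      unfolding * using assms by (intro sum.union_disjoint) auto
  qed
  also have "\<dots> = (\<Sum>i\<in>I. \<Sum>j\<in>{j\<in>I. j < i}. g i j) + (\<Sum>i\<in>I. \<Sum>j\<in>{j\<in>I. i < j}. g i j)"
    by (rule sum.distrib)
  also have "(\<Sum>i\<in>I. \<Sum>j\<in>{j\<in>I. i < j}. g i j) = (\<Sum>j\<in>I. \<Sum>i\<in>{i\<in>I. i < j}. g i j)"
    using sum.swap_restrict[OF assms assms, of g "(<)"] by simp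
  also have "\<dots> = (\<Sum>j\<in>I. \<Sum>i\<in>{i\<in>I. i < j}. - g j i)"
    by (intro sum.cong refl anti) auto
  finally show ?thesis by (simp add: sum_negf)
qed

section \<open>Contraction of cochains by a cone\<close>

definition cone :: "nat \<Rightarrow> (nat set \<Rightarrow> 'k::comm_ring_1) \<Rightarrow> nat set \<Rightarrow> 'k" where
  "cone w c I = (if w \<in> I then 0 else face_sign I w * c (insert w I))"

text \<open>This is the homotopy identity d h + h d = id for h = \<open>cone w\<close>, evaluated at
  \<open>I\<close>; the assumption at \<open>insert w I\<close> kills the term h d.\<close>

lemma simplicial_d_cone:
  assumes "finite I" and "simplicial_d c (insert w I) = 0"
  shows "simplicial_d (cone w c) I = (c I :: 'k::comm_ring_1)"
proof (cases "w \<in> I")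
  case True
  have "simplicial_d (cone w c) I = face_sign I w * cone w c (I - {w})
     + (\<Sum>i\<in>I-{w}. face_sign I i * cone w c (I - {i}))"
    unfolding simplicial_d_def using assms True by (simp add: sum.remove)
  also have "(\<Sum>i\<in>I-{w}. face_sign I i * cone w c (I - {i})) = 0"
    by (rule sum.neutral) (use True in \<open>auto simp: cone_def\<close>)
  also have "face_sign I w * cone w c (I - {w}) = c I"
    using True by (simp add: cone_def insert_absorb flip: mult.assoc)
  finally show ?thesis by simp
next
  case False
  let ?J = "insert w I"
  have Jw: "?J - {w} = I" using False by auto
  have "0 = simplicial_d c ?J" using assms by simp
  also have "\<dots> = face_sign I w * c I + (\<Sum>i\<in>I. face_sign ?J i * c (?J - {i}))"
    unfolding simplicial_d_def using assms False by (simp add: Jw)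
  finally have 0: "(\<Sum>i\<in>I. face_sign ?J i * c (?J - {i})) = - (face_sign I w * c I)"
    by (simp add: eq_neg_iff_add_eq_0 add.commute)
  have "simplicial_d (cone w c) I = (\<Sum>i\<in>I. - (face_sign I w * (face_sign ?J i * c (?J - {i}))))"
    unfolding simplicial_d_def
  proof (rule sum.cong[OF refl])
    fix i assume i: "i \<in> I"
    then have iw: "i \<noteq> w" using False by auto
    have eq: "insert w (I - {i}) = ?J - {i}" using iw by auto
    \<comment> \<open>Exactly one of the two factors changes sign: the second if
      \<open>i < w\<close>, the first if \<open>w < i\<close>.\<close>
    have sgn: "face_sign I i * face_sign (I - {i}) w = - (face_sign I w * (face_sign ?J i :: 'k))"
    proof (cases "i < w")
      case True
      then show ?thesis
        using face_sign_remove_less[OF assms(1) i True, where 'a='k]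
          face_sign_remove_greater[of w i ?J, where 'a='k] by (simp add: Jw)
    next
      case False
      then have "w < i" using iw by simp
      then show ?thesis
        using face_sign_remove_less[of ?J w i, where 'a='k] assms(1)
          face_sign_remove_greater[OF False, of I, where 'a='k] by (simp add: Jw)
    qed
    show "face_sign I i * cone w c (I - {i}) = - (face_sign I w * (face_sign ?J i * c (?J - {i})))"
      using False sgn by (simp add: cone_def eq flip: mult.assoc)
  qed
  also have "\<dots> = face_sign I w * (face_sign I w * c I)"
    unfolding sum_negf sum_distrib_left[symmetric] 0 by simp
  finally show ?thesis by (simp flip: mult.assoc)
qed

lemma simplicial_d_diff: "simplicial_d (\<lambda>I. c I - c' I) I = simplicial_d c I - simplicial_d c' I"
  unfolding simplicial_d_def by (simp add: right_diff_distrib sum_subtractf)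

lemma simplicial_d_nonzeroE:
  assumes "simplicial_d c I \<noteq> 0"
  obtains i where "i \<in> I" "c (I - {i}) \<noteq> 0"
proof -
  have "\<exists>i\<in>I. c (I - {i}) \<noteq> 0"
    using assms unfolding simplicial_d_def by (auto intro: ccontr)
  then show thesis using that by blast
qed

text \<open>
  Induction on \<open>N\<close>. Adding \<open>k\<close> to \<open>N\<close> passes to a subcomplex whose ambient complex is contracted by
  the cone over \<open>w k\<close>, and whose quotient is the complex of \<open>N\<close> on the vertices \<open>v\<close> with \<open>k \<notin> F v\<close>.
  So a cocycle bounds as soon as the restriction of its cone to that quotient does, and tracing the
  cones down to \<open>N = {}\<close> leaves the single value \<open>c (w ` N)\<close> as the obstruction.
\<close>
lemma covering_cocycle_is_coboundary:
  fixes c :: "nat set \<Rightarrow> 'k::comm_ring_1" and F :: "nat \<Rightarrow> 'b set"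
  assumes "finite N" "finite V"
    and "\<And>l. l \<in> N \<Longrightarrow> w l \<in> V"
    and "\<And>l. l \<in> N \<Longrightarrow> F (w l) \<inter> N = {l}"
    and "\<And>I. c I \<noteq> 0 \<Longrightarrow> I \<subseteq> V \<and> card I = j \<and> N \<subseteq> \<Union>(F ` I)"
    and "\<And>I. I \<subseteq> V \<Longrightarrow> simplicial_d c I = 0"
    and "j \<le> card N" and "c (w ` N) = 0"
  shows "\<exists>x. (\<forall>I. x I \<noteq> 0 \<longrightarrow> I \<subseteq> V \<and> Suc (card I) = j \<and> N \<subseteq> \<Union>(F ` I)) \<and>
             (\<forall>I\<subseteq>V. c I = simplicial_d x I)"
  using assms
proof (induction N arbitrary: V c j rule: finite_induct)
  case empty
  \<comment> \<open>With \<open>N\<close> empty, \<open>j\<close> is zero, so only the empty simplex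
    could carry a value. It is the image of \<open>N\<close> under \<open>w\<close>, where
    \<open>c\<close> is assumed to vanish.\<close>
  have "c I = 0" for I
  proof (rule ccontr)
    assume "c I \<noteq> 0"
    moreover from this have "I = {}"
      using empty.prems(4)[of I] empty.prems(6) finite_subset[OF _ empty.prems(1), of I] by auto
    ultimately show False using empty.prems(7) by simp
  qed
  then show ?case by (intro exI[of _ "\<lambda>_. 0"]) (simp add: simplicial_d_def)
next
  case (insert k N)
  define V' where "V' = {v \<in> V. k \<notin> F v}"
  define y where "y = cone (w k) c"
  define y' where "y' I = (if I \<subseteq> V' then y I else 0)" for I
  have finI: "finite I" if "I \<subseteq> V" for I using that insert.prems(1) finite_subset by blast
  have wk: "w k \<in> V" "k \<in> F (w k)" "F (w k) \<inter> insert k N = {k}"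
    using insert.prems(2,3)[of k] by auto
  have V'V: "V' \<subseteq> V" unfolding V'_def by auto
  have dy: "simplicial_d y I = c I" if "I \<subseteq> V" for I
    unfolding y_def using that wk insert.prems(5)[of "insert (w k) I"] finI by (intro simplicial_d_cone) auto
  have ysupp: "I \<subseteq> V \<and> Suc (card I) = j \<and> N \<subseteq> \<Union>(F ` I)" if "y I \<noteq> 0" for I
  proof -
    have "w k \<notin> I" and c: "c (insert (w k) I) \<noteq> 0" using that by (auto simp: y_def cone_def split: if_splits)
    moreover have "N \<subseteq> \<Union>(F ` I)"
      using insert.prems(4)[OF c] wk(3) insert.hyps(2) by auto
    ultimately show ?thesis using insert.prems(4)[OF c] finI[of I] by auto
  qed
  show ?case
  proof (cases j)
    case 0
    then have "y I = 0" for I using ysupp[of I] by auto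
    then have "c I = 0" if "I \<subseteq> V" for I using dy[OF that] by (simp add: simplicial_d_def)
    then show ?thesis by (intro exI[of _ "\<lambda>_. 0"]) (simp add: simplicial_d_def)
  next
    case (Suc j')
    have "\<exists>x. (\<forall>I. x I \<noteq> 0 \<longrightarrow> I \<subseteq> V' \<and> Suc (card I) = j' \<and> N \<subseteq> \<Union>(F ` I)) \<and>
             (\<forall>I\<subseteq>V'. y' I = simplicial_d x I)"
    proof (rule insert.IH)
      show "finite V'" using V'V finI by auto
      show "w l \<in> V'" if "l \<in> N" for l
        unfolding V'_def using insert.prems(2,3)[of l] that insert.hyps(2) by auto
      show "F (w l) \<inter> N = {l}" if "l \<in> N" for l
        using insert.prems(3)[of l] that by auto
      show "I \<subseteq> V' \<and> card I = j' \<and> N \<subseteq> \<Union>(F ` I)" if "y' I \<noteq> 0" for I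
        using that ysupp[of I] Suc by (auto simp: y'_def split: if_splits)
      show "simplicial_d y' I = 0" if "I \<subseteq> V'" for I
      proof -
        \<comment> \<open>Faces of \<open>I\<close> stay inside \<open>V'\<close>, so
          \<open>y'\<close> has coboundary \<open>c\<close> there; and \<open>c\<close> is zero on
          simplices inside \<open>V'\<close>, because they do not cover \<open>k\<close>.\<close>
        have "simplicial_d y' I = simplicial_d y I"
          unfolding simplicial_d_def y'_def using that by (intro sum.cong refl) auto
        also have "\<dots> = c I" using dy that V'V by blast
        also have "\<dots> = 0"
          using insert.prems(4)[of I] that unfolding V'_def by blast
        finally show ?thesis .
      qed
      show "j' \<le> card N" using insert.prems(6) Suc insert.hyps by simp
      \<comment> \<open>The cone adjoins \<open>w k\<close> again, so up to sign this is the value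
        of \<open>c\<close> assumed to vanish for \<open>insert k N\<close>.\<close>
      show "y' (w ` N) = 0"
        using insert.prems(7) by (simp add: y'_def y_def cone_def)
    qed
    then obtain z where z: "\<And>I. z I \<noteq> 0 \<Longrightarrow> I \<subseteq> V' \<and> Suc (card I) = j' \<and> N \<subseteq> \<Union>(F ` I)"
      and dz: "\<And>I. I \<subseteq> V' \<Longrightarrow> y' I = simplicial_d z I" by blast
    \<comment> \<open>Subtracting d z leaves the coboundary unchanged and cancels \<open>y\<close>
      on all simplices inside \<open>V'\<close>, so \<open>x\<close> is supported on simplices that
      cover \<open>k\<close>.\<close>
    define x where "x I = (if I \<subseteq> V then y I - simplicial_d z I else 0)" for I
    have "c I = simplicial_d x I" if "I \<subseteq> V" for I
    proof -
      have "simplicial_d x I = simplicial_d (\<lambda>I. y I - simplicial_d z I) I"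
        unfolding simplicial_d_def[of _ I] x_def using that by (intro sum.cong refl) auto
      then show ?thesis using that finI dy by (simp add: simplicial_d_diff simplicial_d_simplicial_d)
    qed
    moreover have "I \<subseteq> V \<and> Suc (card I) = j \<and> insert k N \<subseteq> \<Union>(F ` I)" if "x I \<noteq> 0" for I
    proof -
      have I: "I \<subseteq> V" using that by (auto simp: x_def split: if_splits)
      have "k \<in> \<Union>(F ` I)"
      proof (rule ccontr)
        assume "k \<notin> \<Union>(F ` I)"
        then have "I \<subseteq> V'" unfolding V'_def using I by auto
        then show False using dz[of I] that I by (auto simp: x_def y'_def)
      qed
      moreover have "y I \<noteq> 0 \<or> simplicial_d z I \<noteq> 0" using that by (auto simp: x_def split: if_splits)
      then have "Suc (card I) = j \<and> N \<subseteq> \<Union>(F ` I)"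
      proof
        assume "simplicial_d z I \<noteq> 0"
        then obtain i where i: "i \<in> I" "z (I - {i}) \<noteq> 0" by (rule simplicial_d_nonzeroE)
        then have "Suc (card (I - {i})) = card I" using finI[OF I] by (metis card_Suc_Diff1)
        then show ?thesis using z[OF i(2)] Suc by auto
      qed (use ysupp in blast)
      ultimately show ?thesis using I by auto
    qed
    ultimately show ?thesis by blast
  qed
qed

section \<open>The semigroup and its localisations\<close>

lemma semigrp_add:
  assumes "b \<in> semigrp U" "b' \<in> semigrp U"
  shows "(\<lambda>i. b i + b' i) \<in> semigrp U"
  using assms(2)
proof induction
  case (step b' u)
  then show ?case using semigrp.step[OF step.IH step.hyps(2)] by (simp add: add.assoc)
qed (use assms in simp)

lemma semigrp_scale:
  assumes "b \<in> semigrp U"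
  shows "(\<lambda>i. int t * b i) \<in> semigrp U"
proof (induction t)
  case (Suc t)
  then show ?case using semigrp_add[OF Suc assms] by (simp add: algebra_simps)
qed (simp add: semigrp.zero)

lemma semigrp_gen: "u \<in> U \<Longrightarrow> u \<in> semigrp U"
  using semigrp.step[OF semigrp.zero] by auto

lemma semigrp_diff_gen:
  assumes "u \<in> U" "(\<lambda>l. s l - u l) \<in> semigrp U"
  shows "s \<in> semigrp U"
  using semigrp.step[OF assms(2,1)] by simp

lemma finite_Tnd: "finite (Tnd n d)"
proof -
  have "Tnd n d \<subseteq> {f. \<forall>x. (x \<in> {..<n} \<longrightarrow> f x \<in> {0..int d}) \<and> (x \<notin> {..<n} \<longrightarrow> f x = 0)}"
  proof (clarsimp simp: Tnd_def)
    fix a :: "nat \<Rightarrow> int" and x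
    assume "\<forall>i. 0 \<le> a i" "(\<Sum>i<n. a i) = int d" "x < n"
    then show "a x \<le> int d" using member_le_sum[of x "{..<n}" a] by simp
  qed
  then show ?thesis by (rule finite_subset) (rule finite_set_of_finite_funs; simp)
qed

lemma set_gens: "finite U \<Longrightarrow> set (gens U) = U"
  unfolding gens_def using someI_ex[OF finite_distinct_list] by blast

text \<open>The vector \<open>(d - 1) e\<^sub>i + e\<^sub>j\<close>; for \<open>i = j\<close> it is \<open>d e\<^sub>i\<close>.\<close>
definition near_vertex :: "nat \<Rightarrow> nat \<Rightarrow> nat \<Rightarrow> nat \<Rightarrow> int" where
  "near_vertex d i j = (\<lambda>l. (if l = i then int d - 1 else 0) + (if l = j then 1 else 0))"

text \<open>For positive \<open>n\<close> and \<open>d\<close> this is the group generated by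
  \<open>Tnd n d\<close>; its nonnegative elements form the full Veronese semigroup.\<close>

definition veronese_lattice :: "nat \<Rightarrow> nat \<Rightarrow> (nat \<Rightarrow> int) set" where
  "veronese_lattice n d = {a. (\<forall>i\<ge>n. a i = 0) \<and> int d dvd (\<Sum>i<n. a i)}"

text \<open>These are the coordinates that may become negative once the generator is
  inverted.\<close>

definition gsupp :: "(nat \<Rightarrow> int) set \<Rightarrow> nat \<Rightarrow> nat set" where
  "gsupp U i = {l. 0 < (gens U ! i) l}"

text \<open>For positive \<open>n\<close> and \<open>d\<close>, the vectors of
  \<open>Tnd n d\<close> with maximum at least d - 1 are exactly the near-vertex vectors, so the
  locale restates the bounds on \<open>U\<close> in usable form.\<close>

locale near_vertex_gens =
  fixes n d :: nat and U :: "(nat \<Rightarrow> int) set"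
  assumes d: "d > 0" and n: "n > 0"
    and near_vertex_in: "\<lbrakk>i < n; j < n\<rbrakk> \<Longrightarrow> near_vertex d i j \<in> U"
    and U_sub: "U \<subseteq> Tnd n d"
begin

abbreviation "B \<equiv> semigrp U"
abbreviation "m \<equiv> length (gens U)"
abbreviation "L \<equiv> veronese_lattice n d"

lemma set_gens_U: "set (gens U) = U"
  using set_gens finite_subset[OF U_sub finite_Tnd] by blast

lemma gens_in_Tnd: "i < m \<Longrightarrow> gens U ! i \<in> Tnd n d"
  using set_gens_U U_sub nth_mem by blast

lemma semigrp_nonneg: "b \<in> B \<Longrightarrow> 0 \<le> b l"
  by (induction rule: semigrp.induct) (use U_sub in \<open>auto simp: Tnd_def intro: add_nonneg_nonneg\<close>)

lemma semigrp_lattice: "b \<in> B \<Longrightarrow> b \<in> L"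
  by (induction rule: semigrp.induct)
    (use U_sub in \<open>auto simp: Tnd_def veronese_lattice_def sum.distrib\<close>)

lemma lattice_combine:
  assumes "a \<in> L" "b \<in> L"
  shows "(\<lambda>l. a l + t * b l) \<in> L"
  using assms by (auto simp: veronese_lattice_def sum.distrib simp flip: sum_distrib_left)

lemma lattice_gen: "u \<in> U \<Longrightarrow> u \<in> L"
  by (intro semigrp_lattice semigrp_gen)

lemma lattice_diff_gen:
  assumes "s \<in> L" "u \<in> U"
  shows "(\<lambda>l. s l - u l) \<in> L"
  using lattice_combine[OF assms(1) lattice_gen[OF assms(2)], of "-1"] by simp

text \<open>
  Copies of \<open>d e\<^sub>j\<close> are split off first; each remaining unit in a coordinate \<open>j \<noteq> i\<close> is paid for
  by \<open>d - 1\<close> units of coordinate \<open>i\<close>.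
\<close>
lemma semigrp_of_reduced_bound:
  assumes "s \<in> L" "\<And>l. 0 \<le> s l" "i < n"
    and "(int d - 1) * (\<Sum>j\<in>{..<n}-{i}. s j mod int d) \<le> s i"
  shows "s \<in> B"
  using assms
proof (induction "nat (\<Sum>j\<in>{..<n}-{i}. s j)" arbitrary: s rule: less_induct)
  case less
  let ?R = "{..<n}-{i}"
  have measure: "nat (\<Sum>j\<in>?R. s' j) < nat (\<Sum>j\<in>?R. s j)"
    if "j \<in> ?R" "s' j < s j" "\<And>l. l \<in> ?R \<Longrightarrow> s' l \<le> s l" "\<And>l. 0 \<le> s' l" for s' j
  proof -
    have "(\<Sum>j\<in>?R. s' j) < (\<Sum>j\<in>?R. s j)"
      by (rule sum_strict_mono_ex1) (use that in auto)
    moreover have "0 \<le> (\<Sum>j\<in>?R. s' j)" using that(4) by (simp add: sum_nonneg)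
    ultimately show ?thesis by simp
  qed
  consider (zero) "\<And>j. j \<in> ?R \<Longrightarrow> s j = 0" | (big) j where "j \<in> ?R" "int d \<le> s j"
    | (small) j where "j \<in> ?R" "0 < s j" "s j < int d"
    using less.prems(2) by (metis linorder_not_less order_le_less)
  then show ?case
  proof cases
    case zero
    have "(\<Sum>j<n. s j) = s i" using less.prems(3) zero by (simp add: sum.remove[of "{..<n}" i])
    then obtain q where q: "s i = int d * q" using less.prems(1) by (auto simp: veronese_lattice_def)
    then have "q \<ge> 0" using less.prems(2)[of i] d by (simp add: zero_le_mult_iff)
    have "s = (\<lambda>l. int (nat q) * near_vertex d i i l)"
    proof
      fix l
      show "s l = int (nat q) * near_vertex d i i l"
        using zero[of l] less.prems(1) q \<open>q \<ge> 0\<close>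
        by (cases "l < n") (auto simp: near_vertex_def veronese_lattice_def algebra_simps less.prems(3))
    qed
    then show ?thesis
      using semigrp_scale[OF semigrp_gen[OF near_vertex_in[OF less.prems(3,3)]], of "nat q"] by simp
  next
    case big
    then have j: "j < n" "j \<noteq> i" by auto
    let ?s = "\<lambda>l. s l - near_vertex d j j l"
    have "?s \<in> B"
    proof (rule less.hyps)
      show nn: "0 \<le> ?s l" for l using less.prems(2)[of l] big by (auto simp: near_vertex_def)
      show "nat (\<Sum>j\<in>?R. ?s j) < nat (\<Sum>j\<in>?R. s j)"
        by (rule measure[of j]) (use big d nn in \<open>auto simp: near_vertex_def\<close>)
      show "?s \<in> L" using lattice_diff_gen less.prems(1) near_vertex_in j by blast
      have "(\<Sum>j\<in>?R. ?s j mod int d) = (\<Sum>j\<in>?R. s j mod int d)"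
        by (intro sum.cong refl) (simp add: near_vertex_def)
      then show "(int d - 1) * (\<Sum>j\<in>?R. ?s j mod int d) \<le> ?s i"
        using less.prems(4) j by (simp add: near_vertex_def)
    qed (use less.prems in auto)
    then show ?thesis using semigrp_diff_gen near_vertex_in j by blast
  next
    case small
    then have j: "j < n" "j \<noteq> i" by auto
    let ?s = "\<lambda>l. s l - near_vertex d i j l"
    have split: "(\<Sum>j\<in>?R. f j) = f j + (\<Sum>j\<in>?R-{j}. f j)" for f :: "nat \<Rightarrow> int"
      using small by (intro sum.remove) auto
    have "(\<Sum>j\<in>?R-{j}. ?s j mod int d) = (\<Sum>j\<in>?R-{j}. s j mod int d)"
      by (intro sum.cong refl) (simp add: near_vertex_def)
    \<comment> \<open>Since \<open>0 < s j < d\<close>, the residue at \<open>j\<close> drops by one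
      without wrapping around. The bound thus loses d - 1, exactly what coordinate \<open>i\<close>
      pays.\<close>
    then have sum_eq: "(\<Sum>j\<in>?R. ?s j mod int d) = (\<Sum>j\<in>?R. s j mod int d) - 1"
      unfolding split using small j by (simp add: near_vertex_def)
    have bound: "(int d - 1) * (\<Sum>j\<in>?R. ?s j mod int d) \<le> ?s i"
      using less.prems(4) j unfolding sum_eq by (simp add: near_vertex_def algebra_simps)
    have "?s \<in> B"
    proof (rule less.hyps)
      show nn: "0 \<le> ?s l" for l
      proof -
        \<comment> \<open>Coordinate \<open>i\<close> stays nonnegative because it dominates the
          left side of \<open>bound\<close>.\<close>
        have "0 \<le> (\<Sum>j\<in>?R. ?s j mod int d)" using d by (intro sum_nonneg) auto
        then have "0 \<le> (int d - 1) * (\<Sum>j\<in>?R. ?s j mod int d)" using d by simp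
        then have "0 \<le> ?s i" using bound by linarith
        then show ?thesis using less.prems(2)[of l] small j by (auto simp: near_vertex_def)
      qed
      show "nat (\<Sum>j\<in>?R. ?s j) < nat (\<Sum>j\<in>?R. s j)"
        by (rule measure[of j]) (use small d nn in \<open>auto simp: near_vertex_def\<close>)
      show "?s \<in> L" using lattice_diff_gen less.prems(1,3) near_vertex_in j by blast
    qed (use less.prems bound in auto)
    then show ?thesis using semigrp_diff_gen near_vertex_in less.prems(3) j by blast
  qed
qed

text \<open>A crude uniform bound: fewer than \<open>n\<close> residues, each below
  \<open>d\<close>, each unit costing d - 1 in \<open>semigrp_of_reduced_bound\<close>.\<close>

definition coord_bound :: int where
  "coord_bound = (int d - 1) * (int n * int d)"

lemma semigrp_of_large_coord:
  assumes "s \<in> L" "\<And>l. 0 \<le> s l" "i < n" "coord_bound \<le> s i"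
  shows "s \<in> B"
proof (rule semigrp_of_reduced_bound[OF assms(1-3)])
  have "(\<Sum>j\<in>{..<n}-{i}. s j mod int d) \<le> (\<Sum>j<n. s j mod int d)"
    using d by (intro sum_mono2) auto
  also have "\<dots> \<le> (\<Sum>j<n. int d)"
    using d by (intro sum_mono) (simp add: order_less_imp_le)
  finally have "(int d - 1) * (\<Sum>j\<in>{..<n}-{i}. s j mod int d) \<le> coord_bound"
    unfolding coord_bound_def using d by (intro mult_left_mono) auto
  then show "(int d - 1) * (\<Sum>j\<in>{..<n}-{i}. s j mod int d) \<le> s i"
    using assms(4) by linarith
qed

text \<open>By pigeonhole some coordinate is large. Hence nonnegative lattice vectors outside
  \<open>B\<close> have bounded degree, and Frobenius can push them past the bound.\<close>

lemma semigrp_of_large_degree: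
  assumes "s \<in> L" "\<And>l. 0 \<le> s l" "int n * coord_bound \<le> (\<Sum>l<n. s l)"
  shows "s \<in> B"
proof -
  have "\<exists>i<n. coord_bound \<le> s i"
  proof (rule ccontr)
    assume "\<not> ?thesis"
    then have "(\<Sum>l<n. s l) < (\<Sum>l<n. coord_bound)"
      using n by (intro sum_strict_mono) (auto simp: not_le)
    then show False using assms(3) by simp
  qed
  then show ?thesis using semigrp_of_large_coord assms by blast
qed

section \<open>Exponent supports of the localisations\<close>

lemma vI_pos_iff:
  assumes "I \<subseteq> {..<m}"
  shows "0 \<le> vI U I l" and "0 < vI U I l \<longleftrightarrow> l \<in> \<Union>(gsupp U ` I)"
proof -
  have nn: "0 \<le> (gens U ! i) l" if "i \<in> I" for i
    using gens_in_Tnd[of i] assms that by (auto simp: Tnd_def)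
  then show ge: "0 \<le> vI U I l" unfolding vI_def by (simp add: sum_nonneg)
  have "finite I" using assms finite_subset by blast
  then have "vI U I l = 0 \<longleftrightarrow> (\<forall>i\<in>I. (gens U ! i) l = 0)"
    unfolding vI_def using nn by (simp add: sum_nonneg_eq_0_iff)
  then show "0 < vI U I l \<longleftrightarrow> l \<in> \<Union>(gsupp U ` I)"
    using ge nn by (fastforce simp: gsupp_def order_le_less)
qed

lemma vI_lattice:
  assumes "I \<subseteq> {..<m}"
  shows "vI U I \<in> L"
proof -
  have *: "gens U ! i \<in> Tnd n d" if "i \<in> I" for i using gens_in_Tnd assms that by auto
  have "(\<Sum>l<n. vI U I l) = (\<Sum>i\<in>I. \<Sum>l<n. (gens U ! i) l)"
    unfolding vI_def by (rule sum.swap)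
  also have "\<dots> = (\<Sum>i\<in>I. int d)" using * by (intro sum.cong refl) (auto simp: Tnd_def)
  finally have "int d dvd (\<Sum>l<n. vI U I l)" by simp
  moreover have "vI U I l = 0" if "l \<ge> n" for l
    unfolding vI_def using * that by (intro sum.neutral) (auto simp: Tnd_def)
  ultimately show ?thesis by (auto simp: veronese_lattice_def)
qed

lemma locsuppD:
  assumes "I \<subseteq> {..<m}" "a \<in> locsupp B (vI U I)"
  shows "a \<in> L" and "a l < 0 \<Longrightarrow> l \<in> \<Union>(gsupp U ` I)"
proof -
  obtain b t where b: "b \<in> B" and a: "a = (\<lambda>i. b i - int t * vI U I i)"
    using assms(2) by (auto simp: locsupp_def)
  show "a \<in> L"
    using lattice_combine[OF semigrp_lattice[OF b] vI_lattice[OF assms(1)], of "- int t"] a by simp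
  show "l \<in> \<Union>(gsupp U ` I)" if "a l < 0"
    using that semigrp_nonneg[OF b, of l] vI_pos_iff[OF assms(1), of l] a
    by (metis diff_ge_0_iff_ge linorder_not_le mult_zero_right order_le_less)
qed

text \<open>Adding a large multiple of \<open>vI U I\<close> clears all negative entries and makes
  some coordinate large, which forces membership in \<open>B\<close>. So for nonempty
  \<open>I\<close> the localisation depends only on the joint support of its generators.\<close>

lemma locsupp_iff:
  assumes "I \<subseteq> {..<m}" "I \<noteq> {}"
  shows "a \<in> locsupp B (vI U I) \<longleftrightarrow> a \<in> L \<and> (\<forall>l. a l < 0 \<longrightarrow> l \<in> \<Union>(gsupp U ` I))"
proof (intro iffI conjI allI impI)
  assume a: "a \<in> L \<and> (\<forall>l. a l < 0 \<longrightarrow> l \<in> \<Union>(gsupp U ` I))"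
  obtain i where i: "i \<in> I" using assms(2) by blast
  then have gi: "gens U ! i \<in> Tnd n d" using gens_in_Tnd assms(1) by auto
  have "\<exists>l<n. 0 < (gens U ! i) l"
  proof (rule ccontr)
    assume "\<not> ?thesis"
    then have "(\<Sum>l<n. (gens U ! i) l) \<le> 0" by (intro sum_nonpos) (meson lessThan_iff not_less)
    then show False using gi d by (simp add: Tnd_def)
  qed
  then obtain k where k: "k < n" "k \<in> \<Union>(gsupp U ` I)" using i by (auto simp: gsupp_def)
  \<comment> \<open>Large enough to absorb any negative entry and still leave
    \<open>coord_bound\<close> in every coordinate of the joint support.\<close>
  define t where "t = nat (coord_bound + (\<Sum>l<n. \<bar>a l\<bar>))"
  have cb: "0 \<le> coord_bound" unfolding coord_bound_def using d by simp
  have t: "int t = coord_bound + (\<Sum>l<n. \<bar>a l\<bar>)"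
    unfolding t_def using cb by (simp add: sum_nonneg)
  have al: "\<bar>a l\<bar> \<le> (\<Sum>l<n. \<bar>a l\<bar>)" if "l < n" for l
    using that by (intro member_le_sum) auto
  have big: "coord_bound \<le> a l + int t * vI U I l" if "l < n" "l \<in> \<Union>(gsupp U ` I)" for l
  proof -
    have "int t * 1 \<le> int t * vI U I l"
      using vI_pos_iff[OF assms(1), of l] that by (intro mult_left_mono) auto
    then show ?thesis using al[OF that(1)] t by linarith
  qed
  let ?b = "\<lambda>l. a l + int t * vI U I l"
  have "?b \<in> B"
  proof (rule semigrp_of_large_coord[where i=k])
    show "?b \<in> L" using lattice_combine a vI_lattice[OF assms(1)] by blast
    show "0 \<le> ?b l" for l
    proof (cases "a l < 0")
      case True
      then have "l < n" using a by (auto simp: veronese_lattice_def not_le[symmetric])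
      then show ?thesis using big[of l] a True cb by auto
    next
      case False
      then show ?thesis using vI_pos_iff(1)[OF assms(1), of l] by simp
    qed
  qed (use k big in auto)
  then show "a \<in> locsupp B (vI U I)"
    unfolding locsupp_def by (auto intro!: bexI[of _ ?b] exI[of _ t])
qed (use locsuppD[OF assms(1)] in auto)

lemma locsupp_empty: "locsupp B (vI U {}) = B"
  by (auto simp: locsupp_def vI_def)

section \<open>Exactness of the Cech complex in a single degree\<close>

definition vertex :: "nat \<Rightarrow> nat" where
  "vertex l = (SOME i. i < m \<and> gens U ! i = near_vertex d l l)"

lemma vertex:
  assumes "l < n"
  shows "vertex l < m" and "gsupp U (vertex l) = {l}"
proof -
  have "\<exists>i. i < m \<and> gens U ! i = near_vertex d l l"
    using near_vertex_in[OF assms assms] set_gens_U by (metis in_set_conv_nth)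
  then have "vertex l < m \<and> gens U ! vertex l = near_vertex d l l"
    unfolding vertex_def by (rule someI_ex)
  then show "vertex l < m" "gsupp U (vertex l) = {l}"
    using d by (auto simp: gsupp_def near_vertex_def split: if_splits)
qed

lemma vertex_inj: "inj_on vertex {..<n}"
  using vertex(2) by (intro inj_onI) (metis lessThan_iff singleton_inject)

text \<open>The assumptions \<open>one\<close> and \<open>neg\<close> remove the only possible
  obstructions. If all coordinates of \<open>a\<close> are negative, the simplices involved are the
  covers of \<open>{..<n}\<close> and the covering lemma applies; otherwise the cone over a vertex
  \<open>k\<close> with \<open>a k \<ge> 0\<close> contracts.\<close>

lemma degreewise_coboundary:
  fixes \<phi> :: "nat set \<Rightarrow> 'k::comm_ring_1"
  assumes supp: "\<And>I. \<phi> I \<noteq> 0 \<Longrightarrow> I \<subseteq> {..<m} \<and> card I = j \<and> a \<in> locsupp B (vI U I)"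
    and cocycle: "\<And>I. I \<subseteq> {..<m} \<Longrightarrow> simplicial_d \<phi> I = 0"
    and one: "\<And>I. \<lbrakk>\<phi> I \<noteq> 0; \<And>l. 0 \<le> a l; j = 1\<rbrakk> \<Longrightarrow> a \<in> B"
    and neg: "(\<And>l. l < n \<Longrightarrow> a l < 0) \<Longrightarrow> j \<le> n \<and> \<phi> (vertex ` {..<n}) = 0"
  shows "\<exists>x. (\<forall>I. x I \<noteq> 0 \<longrightarrow> I \<subseteq> {..<m} \<and> Suc (card I) = j \<and> a \<in> locsupp B (vI U I))
    \<and> (\<forall>I\<subseteq>{..<m}. \<phi> I = simplicial_d x I)"
proof (cases "\<exists>I. \<phi> I \<noteq> 0")
  case False
  then show ?thesis by (intro exI[of _ "\<lambda>_. 0"]) (simp add: simplicial_d_def)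
next
  case True
  then obtain I0 where I0: "\<phi> I0 \<noteq> 0" by blast
  then have aL: "a \<in> L" using supp locsuppD(1) by blast
  have fin: "finite I" if "I \<subseteq> {..<m}" for I using that finite_subset by blast
  show ?thesis
  proof (cases "\<forall>l<n. a l < 0")
    case True
    have "\<exists>x. (\<forall>I. x I \<noteq> 0 \<longrightarrow> I \<subseteq> {..<m} \<and> Suc (card I) = j \<and> {..<n} \<subseteq> \<Union>(gsupp U ` I)) \<and>
             (\<forall>I\<subseteq>{..<m}. \<phi> I = simplicial_d x I)"
    proof (rule covering_cocycle_is_coboundary[where w=vertex])
      show "I \<subseteq> {..<m} \<and> card I = j \<and> {..<n} \<subseteq> \<Union>(gsupp U ` I)" if "\<phi> I \<noteq> 0" for I
        using supp[OF that] locsuppD(2)[of I a] True by blast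
    qed (use vertex cocycle neg True in auto)
    moreover have "a \<in> locsupp B (vI U I)" if "I \<subseteq> {..<m}" "{..<n} \<subseteq> \<Union>(gsupp U ` I)" for I
    proof -
      have "I \<noteq> {}" using that(2) n by auto
      then show ?thesis
        using that aL by (auto simp: locsupp_iff veronese_lattice_def)
          (metis UN_iff lessThan_iff linorder_not_le order_less_irrefl subsetD)
    qed
    ultimately show ?thesis by meson
  next
    case False
    then obtain k where k: "k < n" "0 \<le> a k" by (auto simp: not_less)
    define x where "x = cone (vertex k) \<phi>"
    have "\<phi> I = simplicial_d x I" if "I \<subseteq> {..<m}" for I
      unfolding x_def using cocycle[of "insert (vertex k) I"] that fin vertex(1)[OF k(1)]
      by (subst simplicial_d_cone) auto
    moreover have "I \<subseteq> {..<m} \<and> Suc (card I) = j \<and> a \<in> locsupp B (vI U I)" if "x I \<noteq> 0" for I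
    proof -
      let ?J = "insert (vertex k) I"
      have ni: "vertex k \<notin> I" and J: "\<phi> ?J \<noteq> 0"
        using that by (auto simp: x_def cone_def split: if_splits)
      have I: "I \<subseteq> {..<m}" "Suc (card I) = j"
        using supp[OF J] ni fin[of I] by auto
      \<comment> \<open>The support of \<open>vertex k\<close> is \<open>{k}\<close> and
        \<open>a k\<close> is nonnegative, so dropping this vertex uncovers no negative
        coordinate.\<close>
      have neg: "l \<in> \<Union>(gsupp U ` I)" if "a l < 0" for l
        using locsuppD(2)[of ?J a l] supp[OF J] that vertex(2)[OF k(1)] k(2) by auto
      \<comment> \<open>For empty \<open>I\<close> the localisation is \<open>B\<close> itself,
        which may miss nonnegative lattice vectors. Then \<open>j = 1\<close>, and
        \<open>one\<close> supplies membership.\<close>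
      have "a \<in> locsupp B (vI U I)"
      proof (cases "I = {}")
        case True
        then show ?thesis
          using one[OF J] neg I(2) by (force simp: locsupp_empty not_less[symmetric])
      next
        case False
        then show ?thesis using neg aL I(1) by (simp add: locsupp_iff)
      qed
      with I show ?thesis by blast
    qed
    ultimately show ?thesis by blast
  qed
qed

end

section \<open>Frobenius on Cech cochains\<close>

lemma frobC_iter:
  assumes "p > 0"
  shows "(frobC p ^^ e) \<xi> I a =
    (if \<forall>i. int (p ^ e) dvd a i then (\<xi> I (\<lambda>i. a i div int (p ^ e))) ^ (p ^ e) else 0)"
proof (induction e arbitrary: a)
  case (Suc e)
  let ?q = "int (p ^ e)"
  have "(frobC p ^^ Suc e) \<xi> I a = (if \<forall>i. int p dvd a i
      then ((frobC p ^^ e) \<xi> I (\<lambda>i. a i div int p)) ^ p else 0)"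
    by (simp add: frobC_def frob_def)
  also have "\<dots> = (if (\<forall>i. int p dvd a i) \<and> (\<forall>i. ?q dvd a i div int p)
      then (\<xi> I (\<lambda>i. a i div int p div ?q)) ^ (p ^ e * p) else 0)"
    unfolding Suc.IH using assms by (simp add: power_mult)
  also have "((\<forall>i. int p dvd a i) \<and> (\<forall>i. ?q dvd a i div int p)) \<longleftrightarrow> (\<forall>i. int (p ^ Suc e) dvd a i)"
  proof -
    have "int p dvd x \<and> ?q dvd x div int p \<longleftrightarrow> int (p ^ Suc e) dvd x" for x
      using assms by (auto elim!: dvdE simp: ac_simps)
    then show ?thesis by blast
  qed
  also have "(\<lambda>i. a i div int p div ?q) = (\<lambda>i. a i div int (p ^ Suc e))"
    by (simp add: zdiv_zmult2_eq)
  finally show ?case by (simp add: mult.commute)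
qed simp

lemma frobC_iter_scaled:
  assumes "p > 0"
  shows "(frobC p ^^ e) \<xi> I (\<lambda>i. int (p ^ e) * a i) = (\<xi> I a) ^ (p ^ e)"
  using assms by (simp add: frobC_iter)

lemma frobC_iter_nonzeroE:
  assumes "p > 0" "(frobC p ^^ e) \<xi> I a \<noteq> 0"
  obtains a' where "a = (\<lambda>i. int (p ^ e) * a' i)" "\<xi> I a' \<noteq> 0"
proof
  have "\<forall>i. int (p ^ e) dvd a i" and nz: "(\<xi> I (\<lambda>i. a i div int (p ^ e))) ^ (p ^ e) \<noteq> 0"
    using assms(2) unfolding frobC_iter[OF assms(1)] by (auto split: if_splits)
  then show "a = (\<lambda>i. int (p ^ e) * (a i div int (p ^ e)))" by simp
  show "\<xi> I (\<lambda>i. a i div int (p ^ e)) \<noteq> 0"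
    using nz assms(1) by (metis power_0_left power_not_zero zero_less_power less_irrefl)
qed

lemma simplicial_d_frobenius:
  fixes c :: "nat set \<Rightarrow> 'k::comm_ring_1"
  assumes "prime CHAR('k)" and "q = CHAR('k) ^ e"
  shows "simplicial_d (\<lambda>I. c I ^ q) I = simplicial_d c I ^ q"
proof -
  have "q > 0" using assms by (simp add: prime_gt_0_nat)
  \<comment> \<open>Additivity of the \<open>q\<close>-th power on 1 + (-1) = 0 treats odd and even
    characteristic at once.\<close>
  then have "(-1 :: 'k) ^ q = -1"
    using freshmans_dream'[OF assms, of 1 "-1"] by (simp add: power_0_left eq_neg_iff_add_eq_0 add.commute)
  then have "(face_sign I i :: 'k) ^ q = face_sign I i" for i
    unfolding face_sign_def by (metis power_mult mult.commute)
  then show ?thesis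
    unfolding simplicial_d_def freshmans_dream_sum'[OF assms] by (simp add: power_mult_distrib)
qed

lemma cech_d_eq: "cech_d U c I a = (if I \<subseteq> {..<length (gens U)} then simplicial_d (\<lambda>I. c I a) I else 0)"
  by (simp add: cech_d_def simplicial_d_def face_sign_def)

lemma locsupp_scale:
  assumes "a \<in> locsupp (semigrp U) v"
  shows "(\<lambda>i. int q * a i) \<in> locsupp (semigrp U) v"
proof -
  obtain b t where "b \<in> semigrp U" and a: "a = (\<lambda>i. b i - int t * v i)"
    using assms by (auto simp: locsupp_def)
  then have "(\<lambda>i. int q * b i) \<in> semigrp U" by (simp add: semigrp_scale)
  then show ?thesis
    unfolding locsupp_def a
    by (auto intro!: bexI[of _ "\<lambda>i. int q * b i"] exI[of _ "q * t"] simp: algebra_simps)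
qed

lemma cech_C_nonzeroD:
  assumes "\<xi> \<in> cech_C B U j" "\<xi> I a \<noteq> 0"
  shows "I \<subseteq> {..<length (gens U)} \<and> card I = j \<and> a \<in> locsupp B (vI U I)"
  using assms unfolding cech_C_def lau_elems_def fsupp_def
  by (auto dest!: spec[of _ I] split: if_splits)

lemma cech_C_finite: "\<xi> \<in> cech_C B U j \<Longrightarrow> finite {a. \<xi> I a \<noteq> 0}"
  unfolding cech_C_def lau_elems_def fsupp_def by (auto dest!: spec[of _ I] split: if_splits)

lemma cech_CI:
  assumes "\<And>I a. \<xi> I a \<noteq> 0 \<Longrightarrow> I \<subseteq> {..<length (gens U)} \<and> card I = j \<and> a \<in> locsupp B (vI U I)"
    and "\<And>I. finite {a. \<xi> I a \<noteq> 0}"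
  shows "\<xi> \<in> cech_C B U j"
proof -
  have "\<xi> I = (\<lambda>_. 0)" if "\<not> (I \<subseteq> {..<length (gens U)} \<and> card I = j)" for I
    using assms(1)[of I] that by (intro ext) blast
  moreover have "{a. \<xi> I a \<noteq> 0} \<subseteq> locsupp B (vI U I)" for I
    using assms(1) by blast
  ultimately show ?thesis
    unfolding cech_C_def lau_elems_def fsupp_def using assms(2) by simp
qed

lemma cocyclesD:
  assumes "\<xi> \<in> cocycles B U j"
  shows "\<xi> \<in> cech_C B U j" and "I \<subseteq> {..<length (gens U)} \<Longrightarrow> simplicial_d (\<lambda>I. \<xi> I a) I = 0"
proof -
  show "\<xi> \<in> cech_C B U j" using assms by (simp add: cocycles_def)
  have "cech_d U \<xi> I a = 0" using assms by (simp add: cocycles_def)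
  then show "simplicial_d (\<lambda>I. \<xi> I a) I = 0" if "I \<subseteq> {..<length (gens U)}"
    using that by (simp add: cech_d_eq)
qed

lemma frobC_iter_cech_C:
  assumes "p > 0" "\<xi> \<in> cech_C (semigrp U) U j"
  shows "(frobC p ^^ e) \<xi> \<in> cech_C (semigrp U) U j"
proof (rule cech_CI)
  show "I \<subseteq> {..<length (gens U)} \<and> card I = j \<and> a \<in> locsupp (semigrp U) (vI U I)"
    if "(frobC p ^^ e) \<xi> I a \<noteq> 0" for I a
    using frobC_iter_nonzeroE[OF assms(1) that] cech_C_nonzeroD[OF assms(2)] locsupp_scale by metis
  have "{a. (frobC p ^^ e) \<xi> I a \<noteq> 0} \<subseteq> (\<lambda>a i. int (p ^ e) * a i) ` {a. \<xi> I a \<noteq> 0}" for I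
    by (auto elim!: frobC_iter_nonzeroE[OF assms(1)])
  then show "finite {a. (frobC p ^^ e) \<xi> I a \<noteq> 0}" for I
    using cech_C_finite[OF assms(2)] finite_surj by metis
qed

text \<open>In degrees divisible by q = p^e the differential is the q-th power of the one in the
  divided degree; in all other degrees the image is zero.\<close>

lemma frobC_iter_cocycle:
  fixes \<xi> :: "nat set \<Rightarrow> (nat \<Rightarrow> int) \<Rightarrow> 'k::field"
  assumes "prime CHAR('k)" "\<xi> \<in> cocycles (semigrp U) U j"
  shows "(frobC CHAR('k) ^^ e) \<xi> \<in> cocycles (semigrp U) U j"
proof -
  let ?p = "CHAR('k)"
  have p: "?p > 0" using assms(1) by (simp add: prime_gt_0_nat)
  have "cech_d U ((frobC ?p ^^ e) \<xi>) I a = 0" for I a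
  proof (cases "(\<forall>i. int (?p ^ e) dvd a i) \<and> I \<subseteq> {..<length (gens U)}")
    case True
    then have "cech_d U ((frobC ?p ^^ e) \<xi>) I a
        = simplicial_d (\<lambda>I. \<xi> I (\<lambda>i. a i div int (?p ^ e)) ^ (?p ^ e)) I"
      by (simp add: cech_d_eq frobC_iter[OF p] cong del: if_weak_cong)
    also have "\<dots> = 0"
      using cocyclesD(2)[OF assms(2)] True p by (simp add: simplicial_d_frobenius[OF assms(1) refl])
    finally show ?thesis .
  next
    case False
    show ?thesis
    proof (cases "I \<subseteq> {..<length (gens U)}")
      case True
      then have "(frobC ?p ^^ e) \<xi> J a = 0" for J
        using False frobC_iter[OF p, of e \<xi> J a] by meson
      then show ?thesis by (simp add: cech_d_eq simplicial_d_def)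
    qed (simp add: cech_d_eq)
  qed
  then show ?thesis
    using frobC_iter_cech_C[OF p cocyclesD(1)[OF assms(2)]] by (auto simp: cocycles_def)
qed

text \<open>The differential preserves degrees, so bounding cochains may be chosen degree by degree
  and assembled.\<close>

lemma coboundariesI:
  assumes \<xi>: "\<xi> \<in> cech_C B U j"
    and ex: "\<And>a. \<exists>x. (\<forall>I. x I \<noteq> 0 \<longrightarrow> I \<subseteq> {..<length (gens U)} \<and> Suc (card I) = j \<and> a \<in> locsupp B (vI U I))
      \<and> (\<forall>I\<subseteq>{..<length (gens U)}. \<xi> I a = simplicial_d x I)"
  shows "\<xi> \<in> coboundaries B U j"
proof -
  let ?m = "length (gens U)"
  obtain x where x: "\<And>a I. x a I \<noteq> 0 \<Longrightarrow> I \<subseteq> {..<?m} \<and> Suc (card I) = j \<and> a \<in> locsupp B (vI U I)"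
    and dx: "\<And>a I. I \<subseteq> {..<?m} \<Longrightarrow> \<xi> I a = simplicial_d (x a) I"
    using ex by metis
  \<comment> \<open>Cutting off the degrees in which \<xi> vanishes keeps the support of
    \<open>y\<close> finite.\<close>
  define y where "y I a = (if \<exists>I'. \<xi> I' a \<noteq> 0 then x a I else 0)" for I a
  have d: "\<xi> = cech_d U y"
  proof (intro ext)
    fix I a
    show "\<xi> I a = cech_d U y I a"
    proof (cases "I \<subseteq> {..<?m} \<and> (\<exists>I'. \<xi> I' a \<noteq> 0)")
      case True
      then show ?thesis using dx[of I a] unfolding cech_d_eq y_def by simp
    next
      case False
      then show ?thesis using cech_C_nonzeroD[OF \<xi>, of I a] by (auto simp: cech_d_eq y_def simplicial_d_def)
    qed
  qed
  show ?thesis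
  proof (cases "j = 0")
    case True
    \<comment> \<open>For \<open>j = 0\<close> no simplex satisfies \<open>Suc (card I) = j\<close>,
      so every chosen \<open>x a\<close> is zero.\<close>
    then have "y = (\<lambda>I a. 0)" using x by (auto simp: y_def fun_eq_iff)
    then have "\<xi> = (\<lambda>I a. 0)" unfolding d by (auto simp: cech_d_eq simplicial_d_def fun_eq_iff)
    then show ?thesis by (simp add: coboundaries_def)
  next
    case False
    have "y \<in> cech_C B U (j - 1)"
    proof (rule cech_CI)
      show "I \<subseteq> {..<?m} \<and> card I = j - 1 \<and> a \<in> locsupp B (vI U I)" if "y I a \<noteq> 0" for I a
        using x[of a I] that by (auto simp: y_def split: if_splits)
      have "{a. y I a \<noteq> 0} \<subseteq> (\<Union>I'\<in>Pow {..<?m}. {a. \<xi> I' a \<noteq> 0})" for I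
        using cech_C_nonzeroD[OF \<xi>] by (fastforce simp: y_def split: if_splits)
      then show "finite {a. y I a \<noteq> 0}" for I
        by (rule finite_subset) (use cech_C_finite[OF \<xi>] in auto)
    qed
    then show ?thesis using d False by (auto simp: coboundaries_def)
  qed
qed

section \<open>The two conditions of F-nilpotence\<close>

context near_vertex_gens
begin

text \<open>The vertices form a minimal cover: without vertex \<open>k\<close>, coordinate
  \<open>k\<close> is uncovered. So in a totally negative degree no cochain lives on the facets of
  this simplex.\<close>

lemma coboundary_at_vertices:
  assumes "x \<in> coboundaries B U j" "\<And>k. k < n \<Longrightarrow> g k < 0"
  shows "x (vertex ` {..<n}) g = 0"
proof (rule ccontr)
  let ?I0 = "vertex ` {..<n}"
  assume nz: "x ?I0 g \<noteq> 0"
  then obtain y where y: "y \<in> cech_C B U (j - 1)" and x: "x = cech_d U y"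
    using assms(1) by (auto simp: coboundaries_def)
  have "simplicial_d (\<lambda>I. y I g) ?I0 \<noteq> 0" using nz unfolding x by (simp add: cech_d_eq split: if_splits)
  then obtain i where "i \<in> ?I0" and i: "y (?I0 - {i}) g \<noteq> 0" by (rule simplicial_d_nonzeroE)
  then obtain k where k: "k < n" "i = vertex k" by auto
  have "k \<in> \<Union>(gsupp U ` (?I0 - {i}))"
    using cech_C_nonzeroD[OF y i] locsuppD(2)[of "?I0 - {i}" g k] assms(2)[OF k(1)] by blast
  then show False using k vertex(2) by auto
qed

text \<open>A nonnegative degree in the image is q times a lattice vector, so it is zero or has
  coordinate sum at least q; either way it lies in \<open>B\<close>. The obstruction at the vertices
  is absent, as that simplex has \<open>n > j\<close> elements.\<close>

lemma frobenius_kills_lower_cohomology: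
  assumes p: "prime CHAR('k)" and j: "j < n"
    and \<xi>: "(\<xi> :: nat set \<Rightarrow> (nat \<Rightarrow> int) \<Rightarrow> 'k::field) \<in> cocycles B U j"
    and e: "int n * coord_bound \<le> int (CHAR('k) ^ e)"
  shows "(frobC CHAR('k) ^^ e) \<xi> \<in> coboundaries B U j"
proof -
  let ?q = "CHAR('k) ^ e" and ?\<eta> = "(frobC CHAR('k) ^^ e) \<xi>"
  have p0: "CHAR('k) > 0" using p by (simp add: prime_gt_0_nat)
  have \<eta>: "?\<eta> \<in> cocycles B U j" using frobC_iter_cocycle[OF p \<xi>] .
  note \<eta>C = cocyclesD(1)[OF \<eta>]
  show ?thesis
  proof (rule coboundariesI[OF \<eta>C degreewise_coboundary])
    show "I \<subseteq> {..<m} \<and> card I = j \<and> a \<in> locsupp B (vI U I)" if "?\<eta> I a \<noteq> 0" for I a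
      using cech_C_nonzeroD[OF \<eta>C that] .
    show "simplicial_d (\<lambda>I. ?\<eta> I a) I = 0" if "I \<subseteq> {..<m}" for I a
      using cocyclesD(2)[OF \<eta> that] .
    show "a \<in> B" if nz: "?\<eta> I a \<noteq> 0" and nn: "\<And>l. 0 \<le> a l" for I a
    proof -
      obtain a' where a: "a = (\<lambda>i. int ?q * a' i)" and a': "\<xi> I a' \<noteq> 0"
        using frobC_iter_nonzeroE[OF p0 nz] .
      have a'L: "a' \<in> L"
        using cech_C_nonzeroD[OF cocyclesD(1)[OF \<xi>] a'] locsuppD(1) by blast
      have nn': "0 \<le> a' l" for l
        using nn[of l] p0 unfolding a by (subst (asm) zero_le_mult_iff)
          (metis of_nat_0_less_iff linorder_not_less zero_less_power)
      show ?thesis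
      proof (cases "(\<Sum>l<n. a' l) = 0")
        case True
        then have "\<forall>l<n. a' l = 0" using nn' by (simp add: sum_nonneg_eq_0_iff)
        then have "a' l = 0" for l using a'L by (cases "l < n") (auto simp: veronese_lattice_def)
        then show ?thesis using semigrp.zero by (simp add: a)
      next
        case False
        then have "1 \<le> (\<Sum>l<n. a' l)" using nn' by (simp add: sum_nonneg order_neq_le_trans int_one_le_iff_zero_less)
        then have "int ?q * 1 \<le> int ?q * (\<Sum>l<n. a' l)" by (intro mult_left_mono) auto
        then have "int n * coord_bound \<le> (\<Sum>l<n. a l)"
          using e by (simp add: a sum_distrib_left)
        moreover have "a \<in> L"
          using cech_C_nonzeroD[OF \<eta>C nz] locsuppD(1) by blast
        ultimately show ?thesis using semigrp_of_large_degree nn by blast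
      qed
    qed
    show "j \<le> n \<and> ?\<eta> (vertex ` {..<n}) a = 0" for a
    proof -
      have "card (vertex ` {..<n}) = n" using card_image[OF vertex_inj] by simp
      then show ?thesis using cech_C_nonzeroD[OF \<eta>C, of "vertex ` {..<n}" a] j by auto
    qed
  qed
qed

text \<open>A class that does not bound has a nonzero value at the vertex simplex in some totally
  negative degree \<open>a\<close>. For large q one monomial of \<open>c\<close> isolates the q-th
  power of that value in a degree that is still totally negative, where coboundaries vanish.\<close>

lemma top_tight_closure_zero:
  assumes p: "prime CHAR('k)" and n2: "n \<noteq> 1"
    and \<xi>: "(\<xi> :: nat set \<Rightarrow> (nat \<Rightarrow> int) \<Rightarrow> 'k::field) \<in> cocycles B U n"
    and c: "c \<in> semigroup_ring B" "c \<noteq> (\<lambda>_. 0)"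
    and kills: "\<And>e. e \<ge> e0 \<Longrightarrow> multC c ((frobC CHAR('k) ^^ e) \<xi>) \<in> coboundaries B U n"
  shows "\<xi> \<in> coboundaries B U n"
proof (rule coboundariesI[OF cocyclesD(1)[OF \<xi>] degreewise_coboundary])
  note \<xi>C = cocyclesD(1)[OF \<xi>]
  let ?I0 = "vertex ` {..<n}"
  show "I \<subseteq> {..<m} \<and> card I = n \<and> a \<in> locsupp B (vI U I)" if "\<xi> I a \<noteq> 0" for I a
    using cech_C_nonzeroD[OF \<xi>C that] .
  show "simplicial_d (\<lambda>I. \<xi> I a) I = 0" if "I \<subseteq> {..<m}" for I a
    using cocyclesD(2)[OF \<xi> that] .
  show "a \<in> B" if "n = 1" for a using that n2 by simp
  show "n \<le> n \<and> \<xi> ?I0 a = 0" if neg: "\<And>l. l < n \<Longrightarrow> a l < 0" for a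
  proof (intro conjI ccontr[of "\<xi> ?I0 a = 0"] order_refl)
    assume nz: "\<xi> ?I0 a \<noteq> 0"
    have finc: "finite (fsupp c)" and subc: "fsupp c \<subseteq> B" using c(1) by (auto simp: lau_elems_def)
    obtain b where b: "b \<in> fsupp c" using c(2) by (auto simp: fsupp_def)
    \<comment> \<open>As exponents are nonnegative, this total bounds every coordinate of every
      exponent in \<open>c\<close>.\<close>
    define M where "M = (\<Sum>b'\<in>fsupp c. \<Sum>l<n. b' l)"
    have inner_nonneg: "0 \<le> (\<Sum>l<n. b' l)" if "b' \<in> fsupp c" for b'
      using semigrp_nonneg subc that by (intro sum_nonneg) blast
    have range: "0 \<le> b' l \<and> b' l \<le> M" if "b' \<in> fsupp c" for b' l
    proof
      show nn: "0 \<le> b' l" using semigrp_nonneg subc that by blast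
      have "(\<Sum>l<n. b' l) \<le> M"
        unfolding M_def using that finc inner_nonneg by (intro member_le_sum) auto
      moreover have "b' l \<le> (\<Sum>l<n. b' l)"
      proof (cases "l < n")
        case True
        have "0 \<le> b' i" for i using semigrp_nonneg subc that by blast
        with True show ?thesis by (intro member_le_sum) auto
      next
        case False
        then have "b' l = 0" using semigrp_lattice that subc by (auto simp: veronese_lattice_def)
        then show ?thesis using inner_nonneg[OF that] by simp
      qed
      ultimately show "b' l \<le> M" by linarith
    qed
    define e where "e = max e0 (nat M)"
    let ?q = "CHAR('k) ^ e"
    have p0: "CHAR('k) > 0" using p by (simp add: prime_gt_0_nat)
    have "e < ?q" using prime_ge_2_nat[OF p] by (simp add: power_gt_expt)
    then have Mq: "M < int ?q" unfolding e_def by linarith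
    \<comment> \<open>The degree of x^b times the Frobenius image of the component in degree
      \<open>a\<close>.\<close>
    define g where "g = (\<lambda>l. int ?q * a l + b l)"
    have "lmult c ((frobC CHAR('k) ^^ e) \<xi> ?I0) g
        = (\<Sum>b'\<in>fsupp c. if b' = b then c b * \<xi> ?I0 a ^ ?q else 0)"
      unfolding lmult_def
    proof (rule sum.cong[OF refl])
      fix b' assume b': "b' \<in> fsupp c"
      show "c b' * (frobC CHAR('k) ^^ e) \<xi> ?I0 (\<lambda>i. g i - b' i)
          = (if b' = b then c b * \<xi> ?I0 a ^ ?q else 0)"
      proof (cases "b' = b")
        case True
        then show ?thesis using frobC_iter_scaled[OF p0, of e \<xi> ?I0 a] by (simp add: g_def)
      next
        case False
        have "(frobC CHAR('k) ^^ e) \<xi> ?I0 (\<lambda>i. g i - b' i) = 0"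
        proof (rule ccontr)
          assume "\<not> ?thesis"
          then obtain a' where a': "(\<lambda>i. g i - b' i) = (\<lambda>i. int ?q * a' i)"
            and "\<xi> ?I0 a' \<noteq> 0" by (rule frobC_iter_nonzeroE[OF p0])
          have "b' l = b l" for l
          proof -
            \<comment> \<open>Two exponents of \<open>c\<close> contributing to degree
              \<open>g\<close> are congruent modulo q, while their entries differ by less than q, so
              they coincide.\<close>
            have "b l - b' l = int ?q * (a' l - a l)"
              using fun_cong[OF a', of l] by (simp add: g_def algebra_simps)
            then have "int ?q dvd b l - b' l" by simp
            moreover have "\<bar>b l - b' l\<bar> < int ?q"
              using range[OF b, of l] range[OF b', of l] Mq by linarith
            ultimately show ?thesis
              using dvd_imp_le_int[of "b l - b' l" "int ?q"] by force
          qed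
          then show False using False by auto
        qed
        then show ?thesis using False by simp
      qed
    qed
    also have "\<dots> = c b * \<xi> ?I0 a ^ ?q" using b finc by simp
    finally have "multC c ((frobC CHAR('k) ^^ e) \<xi>) ?I0 g \<noteq> 0"
      using b nz by (simp add: multC_def fsupp_def)
    moreover have "g k < 0" if "k < n" for k
    proof -
      \<comment> \<open>Each \<open>a k\<close> is at most -1, so \<open>g k\<close> is at most M -
        q, which is negative.\<close>
      have "int ?q * a k \<le> int ?q * (-1)"
        using neg[OF that] by (intro mult_left_mono) auto
      then show ?thesis using range[OF b, of k] Mq unfolding g_def by linarith
    qed
    ultimately show False
      using coboundary_at_vertices kills[of e] unfolding e_def by (meson max.cobounded1)
  qed
qed

end

lemma near_vertex_gensI:
  assumes "n \<ge> 2" "d > 2"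
    and "{m \<in> Tnd n d. maxv n m \<ge> int d - 1} \<subseteq> U" "U \<subseteq> Tnd n d"
  shows "near_vertex_gens n d U"
proof
  show "near_vertex d i j \<in> U" if "i < n" "j < n" for i j
  proof -
    have "near_vertex d i j \<in> Tnd n d"
      using assms(1,2) that by (auto simp: Tnd_def near_vertex_def sum.distrib)
    moreover have "int d - 1 \<le> near_vertex d i j i" by (simp add: near_vertex_def)
    then have "int d - 1 \<le> maxv n (near_vertex d i j)"
      unfolding maxv_def using that by (meson Max_ge finite_imageI finite_lessThan imageI lessThan_iff order_trans)
    ultimately show ?thesis using assms(3) by blast
  qed
qed (use assms in auto)

theorem theorem5p4:
  fixes n d :: nat and U :: "(nat \<Rightarrow> int) set"
  assumes "prime CHAR('k::field)"
    and "F_finite_field TYPE('k)"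
    and "n \<ge> 2" and "d > 2"
    and "{m \<in> Tnd n d. maxv n m \<ge> int d - 1} \<subseteq> U" and "U \<subseteq> Tnd n d"
  shows "F_nilpotent_sg TYPE('k) n (semigrp U) U"
proof -
  interpret near_vertex_gens n d U using near_vertex_gensI[OF assms(3-6)] .
  \<comment> \<open>Since \<open>e < p ^ e\<close>, the bound itself serves as exponent, for all
    \<open>j < n\<close> at once.\<close>
  define e where "e = nat (int n * coord_bound)"
  have "e < CHAR('k) ^ e" using prime_ge_2_nat[OF assms(1)] by (simp add: power_gt_expt)
  then have e: "int n * coord_bound \<le> int (CHAR('k) ^ e)" unfolding e_def by linarith
  have top: "\<xi> \<in> coboundaries B U n"
    if "\<xi> \<in> cocycles B U n"
      and "\<exists>c\<in>semigroup_ring B. c \<noteq> (\<lambda>_. 0) \<and>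
        (\<exists>e0. \<forall>e'\<ge>e0. multC c ((frobC CHAR('k) ^^ e') \<xi>) \<in> coboundaries B U n)"
    for \<xi> :: "nat set \<Rightarrow> (nat \<Rightarrow> int) \<Rightarrow> 'k"
    using that top_tight_closure_zero[OF assms(1) _ that(1)] assms(3) by auto
  show ?thesis
    unfolding F_nilpotent_sg_def
  proof (rule conjI, goal_cases)
    case 1
    show ?case using frobenius_kills_lower_cohomology[OF assms(1) _ _ e] by blast
  next
    case 2
    \<comment> \<open>No Frobenius is required here: classes in the tight closure of zero already
      bound.\<close>
    show ?case by (rule exI[of _ 0]) (simp add: top)
  qed
qed

end
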